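(* Let $n\ge 1$ and consider the function $\mathbf{y}=\mathrm{ReLU}(\mathbf{x})$ on $\mathbb{R}^n$. If the input set $\mathcal{X}\subset\mathbb{R}^n$ is a union of (finitely many) polyhedra, then the output reachable set $\mathcal{Y}=\{\mathrm{ReLU}(\mathbf{x})\mid\mathbf{x}\in\mathcal{X}\}$ is also a union of (finitely many) polyhedra.
   Context: For a real number $x$, $\mathrm{ReLU}(x)=0$ if $x\le 0$ and $\mathrm{ReLU}(x)=x$ if $x>0$; on $\mathbb{R}^n$, $\mathrm{ReLU}$ is applied element-wise. A polyhedron in $\mathbb{R}^n$ is a set of the form $\{\mathbf{x}\in\mathbb{R}^n\mid\mathbf{A}\mathbf{x}\le\mathbf{b}\}$ with a real matrix $\mathbf{A}$ (finitely many rows) and real vector $\mathbf{b}$, the inequality being element-wise; it may be empty. A union of polyhedra means a set of the form $\bigcup_{s=1}^{N}\mathcal{X}_s$ with each $\mathcal{X}_s$ a polyhedron. *)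

theory Defs
  imports "HOL-Analysis.Analysis"
begin

definition relu :: "real \<Rightarrow> real" where
  "relu x = (if x \<le> 0 then 0 else x)"

definition relu_vec :: "real ^ 'n \<Rightarrow> real ^ 'n" where
  "relu_vec x = (\<chi> i. relu (x $ i))"

text \<open>
  \<^const>\<open>polyhedron\<close> is the library notion: a finite intersection of closed half-spaces with
  nonzero normals. The following lemma shows that on \<open>real ^ 'n\<close> these are exactly the sets
  \<open>{x. A x \<le> b}\<close>, where \<open>A\<close> has finitely many, arbitrary (possibly zero) rows \<open>A i\<close>, \<open>i < m\<close>.
  The number of rows is a natural number because it is existentially quantified.
\<close>

lemma polyhedron_iff_matrix_form:
  fixes S :: "(real ^ 'n) set"
  shows "polyhedron S \<longleftrightarrow>
    (\<exists>(m::nat) (A :: nat \<Rightarrow> real ^ 'n) (b :: nat \<Rightarrow> real).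
      S = {x. \<forall>i<m. (\<Sum>j\<in>UNIV. A i $ j * x $ j) \<le> b i})"
proof
  assume "polyhedron S"
  then obtain F where F: "finite F" "S = \<Inter> F"
    "\<forall>h\<in>F. \<exists>a b. a \<noteq> 0 \<and> h = {x. a \<bullet> x \<le> b}"
    unfolding polyhedron_def by blast
  from F(3) obtain a b where ab: "\<And>h. h \<in> F \<Longrightarrow> h = {x. a h \<bullet> x \<le> b h}"
    by metis
  obtain hs where hs: "set hs = F"
    using finite_list[OF F(1)] by blast
  have "S = {x. \<forall>h\<in>F. a h \<bullet> x \<le> b h}"
    using F(2) ab by blast
  also have "\<dots> = {x. \<forall>i<length hs. (\<Sum>j\<in>UNIV. a (hs ! i) $ j * x $ j) \<le> b (hs ! i)}"
    unfolding hs[symmetric] by (auto simp: all_set_conv_all_nth inner_vec_def)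
  finally show "\<exists>(m::nat) (A :: nat \<Rightarrow> real ^ 'n) (b :: nat \<Rightarrow> real).
      S = {x. \<forall>i<m. (\<Sum>j\<in>UNIV. A i $ j * x $ j) \<le> b i}"
    by (intro exI[of _ "length hs"] exI[of _ "\<lambda>i. a (hs ! i)"] exI[of _ "\<lambda>i. b (hs ! i)"])
next
  assume "\<exists>(m::nat) (A :: nat \<Rightarrow> real ^ 'n) (b :: nat \<Rightarrow> real).
      S = {x. \<forall>i<m. (\<Sum>j\<in>UNIV. A i $ j * x $ j) \<le> b i}"
  then obtain m and A :: "nat \<Rightarrow> real ^ 'n" and b
    where S: "S = {x. \<forall>i<m. (\<Sum>j\<in>UNIV. A i $ j * x $ j) \<le> b i}"
    by blast
  have "S = \<Inter> ((\<lambda>i. {x. A i \<bullet> x \<le> b i}) ` {..<m})"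
    unfolding S by (auto simp: inner_vec_def)
  moreover have "polyhedron (\<Inter> ((\<lambda>i. {x. A i \<bullet> x \<le> b i}) ` {..<m}))"
    by (rule polyhedron_Inter) (auto simp: polyhedron_halfspace_le)
  ultimately show "polyhedron S" by simp
qed

definition union_of_polyhedra :: "(real ^ 'n) set \<Rightarrow> bool" where
  "union_of_polyhedra X \<longleftrightarrow>
    (\<exists>(N::nat) (P :: nat \<Rightarrow> (real ^ 'n) set).
      1 \<le> N \<and> (\<forall>s\<in>{1..N}. polyhedron (P s)) \<and> X = (\<Union>s\<in>{1..N}. P s))"

end

theory Submission
  imports Defs
begin

text \<open>
  ReLU is the composition of the maps that clip one coordinate each, so it suffices to treat
  clipping the coordinate \<open>i\<close>. It fixes the part of a polyhedron with \<open>x $ i \<ge> 0\<close> and projects the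
  part with \<open>x $ i \<le> 0\<close> onto the hyperplane \<open>x $ i = 0\<close>. That projection is the sum of the
  polyhedron with the \<open>i\<close>-th coordinate axis, intersected with the hyperplane, and by
  Fourier-Motzkin elimination the sum of a polyhedron with a line is a polyhedron.
\<close>

text \<open>This is the elimination of a single variable: \<open>L\<close> and \<open>U\<close> hold
  its lower and upper bounds. \<open>Max L\<close> is a witness, \<open>Min U\<close> if
  \<open>L\<close> is empty, and any real if both are empty.\<close>

lemma finite_sets_separated_by_point_iff:
  fixes L U :: "real set"
  assumes "finite L" "finite U"
  shows "(\<exists>t. (\<forall>l\<in>L. l \<le> t) \<and> (\<forall>u\<in>U. t \<le> u)) \<longleftrightarrow> (\<forall>l\<in>L. \<forall>u\<in>U. l \<le> u)"
proof
  assume sep: "\<forall>l\<in>L. \<forall>u\<in>U. l \<le> u"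
  show "\<exists>t. (\<forall>l\<in>L. l \<le> t) \<and> (\<forall>u\<in>U. t \<le> u)"
  proof (cases "L = {}")
    case True
    show ?thesis
    proof (cases "U = {}")
      case False
      then show ?thesis
        using True assms by (intro exI[of _ "Min U"]) auto
    qed (use True in auto)
  next
    case False
    then show ?thesis
      using sep assms by (intro exI[of _ "Max L"]) auto
  qed
qed force

text \<open>Along direction \<open>e\<close> each constraint either ignores \<open>t\<close> or
  bounds it from one side. A suitable \<open>t\<close> exists iff every lower bound is at most every
  upper bound, which is a finite system of linear conditions on \<open>y\<close>.\<close>

lemma polyhedron_plus_line:
  fixes P :: "'a::euclidean_space set"
  assumes "polyhedron P"
  shows "polyhedron {y. \<exists>t. y + t *\<^sub>R e \<in> P}"
proof -
  obtain F where F: "finite F" "P = \<Inter> F" "\<forall>h\<in>F. \<exists>a b. a \<noteq> 0 \<and> h = {x. a \<bullet> x \<le> b}"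
    using assms unfolding polyhedron_def by blast
  from F(3) obtain a b where ab: "\<And>h. h \<in> F \<Longrightarrow> h = {x. a h \<bullet> x \<le> b h}"
    by metis
  have P: "P = {x. \<forall>h\<in>F. a h \<bullet> x \<le> b h}"
    using F(2) ab by blast
  define Z where "Z = {h\<in>F. a h \<bullet> e = 0}"
  define pos where "pos = {h\<in>F. a h \<bullet> e > 0}"
  define neg where "neg = {h\<in>F. a h \<bullet> e < 0}"
  have fin: "finite Z" "finite pos" "finite neg"
    using F(1) by (auto simp: Z_def pos_def neg_def)
  have split: "F = Z \<union> pos \<union> neg"
    by (auto simp: Z_def pos_def neg_def)
  \<comment> \<open>\<open>bd h y\<close> is the parameter \<open>t\<close> at which the line
    through \<open>y\<close> crosses the boundary of \<open>h\<close>. The sign of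
    \<open>a h \<bullet> e\<close> makes it an upper or a lower bound.\<close>
  define bd where "bd h y = (b h - a h \<bullet> y) / (a h \<bullet> e)" for h y
  have zero: "a h \<bullet> (y + t *\<^sub>R e) \<le> b h \<longleftrightarrow> a h \<bullet> y \<le> b h" if "h \<in> Z" for h y t
    using that by (simp add: Z_def inner_simps)
  have upper: "a h \<bullet> (y + t *\<^sub>R e) \<le> b h \<longleftrightarrow> t \<le> bd h y" if "h \<in> pos" for h y t
    using that by (simp add: pos_def bd_def inner_simps field_simps)
  have lower: "a h \<bullet> (y + t *\<^sub>R e) \<le> b h \<longleftrightarrow> bd h y \<le> t" if "h \<in> neg" for h y t
    using that by (simp add: neg_def bd_def inner_simps field_simps)
  have iff: "(\<exists>t. y + t *\<^sub>R e \<in> P) \<longleftrightarrow>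
      (\<forall>h\<in>Z. a h \<bullet> y \<le> b h) \<and> (\<forall>q\<in>neg. \<forall>p\<in>pos. bd q y \<le> bd p y)" for y
  proof -
    have "(\<exists>t. y + t *\<^sub>R e \<in> P) \<longleftrightarrow> (\<forall>h\<in>Z. a h \<bullet> y \<le> b h) \<and>
        (\<exists>t. (\<forall>l\<in>(\<lambda>h. bd h y) ` neg. l \<le> t) \<and> (\<forall>u\<in>(\<lambda>h. bd h y) ` pos. t \<le> u))"
      unfolding P split by (auto simp: zero upper lower ball_Un)
    also have "\<dots> \<longleftrightarrow> (\<forall>h\<in>Z. a h \<bullet> y \<le> b h) \<and>
        (\<forall>q\<in>neg. \<forall>p\<in>pos. bd q y \<le> bd p y)"
      using fin by (subst finite_sets_separated_by_point_iff) auto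
    finally show ?thesis .
  qed
  have pair: "polyhedron {y. bd q y \<le> bd p y}" for p q
  proof -
    \<comment> \<open>For fixed \<open>h\<close>, \<open>bd h y\<close> is affine in
      \<open>y\<close>, so comparing two bounds gives one linear inequality. Its normal may be zero,
      which \<open>polyhedron_halfspace_le\<close> admits.\<close>
    have "{y. bd q y \<le> bd p y} =
        {y. (a p /\<^sub>R (a p \<bullet> e) - a q /\<^sub>R (a q \<bullet> e)) \<bullet> y \<le> b p / (a p \<bullet> e) - b q / (a q \<bullet> e)}"
      by (auto simp: bd_def inner_simps diff_divide_distrib divide_inverse algebra_simps)
    then show ?thesis
      using polyhedron_halfspace_le by metis
  qed
  have "{y. \<exists>t. y + t *\<^sub>R e \<in> P} = \<Inter> ((\<lambda>h. {y. a h \<bullet> y \<le> b h}) ` Z) \<inter>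
      \<Inter> ((\<lambda>(q, p). {y. bd q y \<le> bd p y}) ` (neg \<times> pos))"
    unfolding iff by auto
  also have "polyhedron \<dots>"
    using fin by (intro polyhedron_Int polyhedron_Inter)
      (auto simp: pair polyhedron_halfspace_le)
  finally show ?thesis .
qed

text \<open>Passing to an unindexed finite family avoids renumbering when one polyhedron is replaced
  by two.\<close>

lemma union_of_polyhedra_iff_finite_Union:
  "union_of_polyhedra X \<longleftrightarrow> (\<exists>F. finite F \<and> (\<forall>P\<in>F. polyhedron P) \<and> X = \<Union> F)"
proof
  assume "union_of_polyhedra X"
  then obtain N P where "\<forall>s\<in>{1..N::nat}. polyhedron (P s)" "X = (\<Union>s\<in>{1..N}. P s)"
    unfolding union_of_polyhedra_def by blast
  then show "\<exists>F. finite F \<and> (\<forall>P\<in>F. polyhedron P) \<and> X = \<Union> F"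
    by (intro exI[of _ "P ` {1..N}"]) auto
next
  assume "\<exists>F. finite F \<and> (\<forall>P\<in>F. polyhedron P) \<and> X = \<Union> F"
  then obtain F where F: "finite F" "\<forall>P\<in>F. polyhedron P" "X = \<Union> F"
    by blast
  \<comment> \<open>Adding the empty polyhedron ensures that there is at least one member.\<close>
  let ?G = "insert {} F"
  obtain P where "bij_betw P {1..card ?G} ?G"
    using ex_bij_betw_nat_finite_1[of ?G] F(1) by auto
  then have im: "P ` {1..card ?G} = ?G"
    by (rule bij_betw_imp_surj_on)
  have "1 \<le> card ?G"
    using F(1) card_gt_0_iff[of ?G] by (metis One_nat_def Suc_leI finite.insertI insert_not_empty)
  moreover have "\<forall>s\<in>{1..card ?G}. polyhedron (P s)"
    using im F(2) by (metis imageI insertE polyhedron_empty)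
  moreover have "X = (\<Union>s\<in>{1..card ?G}. P s)"
    unfolding im F(3) by simp
  ultimately show "union_of_polyhedra X"
    unfolding union_of_polyhedra_def by blast
qed

definition clip :: "'n::finite \<Rightarrow> real ^ 'n \<Rightarrow> real ^ 'n" where
  "clip i x = (\<chi> j. if j = i then relu (x $ j) else x $ j)"

text \<open>Both half-spaces are closed, so that the pieces stay polyhedra. They overlap harmlessly
  where \<open>x $ i = 0\<close>, since \<open>clip i\<close> is the identity there.\<close>

lemma clip_image:
  "clip i ` P = (P \<inter> {x. 0 \<le> x $ i}) \<union>
     ({y. \<exists>t. y + t *\<^sub>R axis i 1 \<in> P \<inter> {x. x $ i \<le> 0}} \<inter> {y. y $ i = 0})"
proof (intro set_eqI iffI)
  fix y assume "y \<in> clip i ` P"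
  then obtain x where x: "x \<in> P" "y = clip i x"
    by blast
  show "y \<in> (P \<inter> {x. 0 \<le> x $ i}) \<union>
     ({y. \<exists>t. y + t *\<^sub>R axis i 1 \<in> P \<inter> {x. x $ i \<le> 0}} \<inter> {y. y $ i = 0})"
  proof (cases "0 \<le> x $ i")
    case True
    then have "y = x"
      using x by (auto simp: clip_def relu_def vec_eq_iff)
    then show ?thesis
      using True x by simp
  next
    case False
    \<comment> \<open>Clipping only replaced the negative coordinate \<open>x $ i\<close> by 0, so
      adding it back along the axis recovers \<open>x\<close>.\<close>
    then have "y + (x $ i) *\<^sub>R axis i 1 = x" "y $ i = 0"
      using x by (auto simp: clip_def relu_def vec_eq_iff axis_def)
    then have "y + (x $ i) *\<^sub>R axis i 1 \<in> P \<inter> {x. x $ i \<le> 0}"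
      using x False by simp
    then show ?thesis
      using \<open>y $ i = 0\<close> by blast
  qed
next
  fix y assume "y \<in> (P \<inter> {x. 0 \<le> x $ i}) \<union>
     ({y. \<exists>t. y + t *\<^sub>R axis i 1 \<in> P \<inter> {x. x $ i \<le> 0}} \<inter> {y. y $ i = 0})"
  then consider "y \<in> P" "0 \<le> y $ i"
    | t where "y + t *\<^sub>R axis i 1 \<in> P" "(y + t *\<^sub>R axis i 1) $ i \<le> 0" "y $ i = 0"
    by blast
  then show "y \<in> clip i ` P"
  proof cases
    case 1
    then have "y = clip i y"
      by (auto simp: clip_def relu_def vec_eq_iff)
    then show ?thesis
      using 1 by blast
  next
    case 2
    then have "y = clip i (y + t *\<^sub>R axis i 1)"
      by (auto simp: clip_def relu_def vec_eq_iff axis_def)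
    then show ?thesis
      using 2 by blast
  qed
qed

text \<open>Images commute with unions, so each member \<open>P\<close> contributes the two pieces
  from \<open>clip_image\<close>.\<close>

lemma union_of_polyhedra_clip:
  fixes X :: "(real ^ 'n) set"
  assumes "union_of_polyhedra X"
  shows "union_of_polyhedra (clip i ` X)"
proof -
  obtain F where F: "finite F" "\<forall>P\<in>F. polyhedron P" "X = \<Union> F"
    using assms unfolding union_of_polyhedra_iff_finite_Union by blast
  define A where "A P = P \<inter> {x. 0 \<le> x $ i}" for P :: "(real ^ 'n) set"
  define B where "B P = {y. \<exists>t. y + t *\<^sub>R axis i 1 \<in> P \<inter> {x. x $ i \<le> 0}} \<inter> {y. y $ i = 0}"
    for P :: "(real ^ 'n) set"
  have half: "polyhedron {x :: real ^ 'n. 0 \<le> x $ i}" "polyhedron {x :: real ^ 'n. x $ i \<le> 0}"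
    "polyhedron {x :: real ^ 'n. x $ i = 0}"
    using polyhedron_halfspace_ge[of 0 "axis i 1 :: real ^ 'n"]
      polyhedron_halfspace_le[of "axis i 1 :: real ^ 'n" 0]
      polyhedron_hyperplane[of "axis i 1 :: real ^ 'n" 0]
    by (simp_all add: inner_axis')
  have "polyhedron (A P)" "polyhedron (B P)" if "P \<in> F" for P
  proof -
    have "polyhedron P"
      using F(2) that by blast
    then show "polyhedron (A P)" "polyhedron (B P)"
      unfolding A_def B_def by (intro polyhedron_Int polyhedron_plus_line half; assumption)+
  qed
  moreover have "clip i ` X = \<Union> (A ` F \<union> B ` F)"
  proof -
    have "clip i ` X = (\<Union>P\<in>F. clip i ` P)"
      using F(3) by blast
    also have "\<dots> = (\<Union>P\<in>F. A P \<union> B P)"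
      by (simp only: clip_image A_def B_def)
    finally show ?thesis
      by (simp add: UN_Un_distrib Union_Un_distrib)
  qed
  ultimately show ?thesis
    unfolding union_of_polyhedra_iff_finite_Union using F(1)
    by (intro exI[of _ "A ` F \<union> B ` F"] conjI ballI) (blast | assumption)+
qed

theorem corollary1:
  fixes X :: "(real ^ 'n) set"
  assumes "union_of_polyhedra X"
  shows "union_of_polyhedra {relu_vec x | x. x \<in> X}"
proof -
  \<comment> \<open>Generalizing to a set \<open>I\<close> of clipped coordinates allows induction
    from the identity at \<open>{}\<close> to \<open>relu_vec\<close> at
    \<open>UNIV\<close>.\<close>
  define f :: "'n set \<Rightarrow> real ^ 'n \<Rightarrow> real ^ 'n"
    where "f I x = (\<chi> j. if j \<in> I then relu (x $ j) else x $ j)" for I x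
  have "union_of_polyhedra (f I ` X)" for I
    using finite[of I]
  proof (induction I rule: finite_induct)
    case empty
    have "f {} ` X = X"
      by (simp add: f_def)
    then show ?case
      using assms by simp
  next
    case (insert i I)
    \<comment> \<open>Since \<open>i\<close> is not in \<open>I\<close>, \<open>f I\<close> leaves
      coordinate \<open>i\<close> untouched, and \<open>clip i\<close> applies \<open>relu\<close>
      to the original entry.\<close>
    have "f (insert i I) x = clip i (f I x)" for x
      using insert.hyps by (auto simp: f_def clip_def vec_eq_iff)
    then have "f (insert i I) ` X = clip i ` f I ` X"
      by (simp add: image_image)
    then show ?case
      using union_of_polyhedra_clip[OF insert.IH] by simp
  qed
  moreover have "f UNIV = relu_vec"
    by (simp add: f_def relu_vec_def fun_eq_iff)
  ultimately show ?thesis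
    by (metis Setcompr_eq_image)
qed

end
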